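(* Let $s_1<s_2$ be real numbers and let $x_c,y_c,r\in C^2([s_1,s_2])$ be real-valued functions such that for all $t\in(s_1,s_2)$, $r(t)>0$ and $$r'(t)^2< x_c'(t)^2+y_c'(t)^2.$$ Let $F(x,y,t)=(x-x_c(t))^2+(y-y_c(t))^2-r(t)^2$. For each $t\in[s_1,s_2]$ let $\mathcal{C}_t=\{(x,y)\in\mathbb{R}^2:F(x,y,t)=0\}$ and let $\mathcal{D}_t$ be the open disk with boundary $\mathcal{C}_t$. Let $\mathcal{F}$ be the family of circles $\{\mathcal{C}_t\}_{t\in[s_1,s_2]}$, with limiting-position envelope $E_2$ and discriminant envelope $E_3$, and let $\Omega=\bigcup_{t\in[s_1,s_2]}\mathcal{D}_t$. Then $$\partial\Omega\subseteq E_2\cup\mathcal{C}_{s_1}\cup\mathcal{C}_{s_2}\subseteq E_3\cup\mathcal{C}_{s_1}\cup\mathcal{C}_{s_2}.$$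
   Context: The limiting-position envelope $E_2$ of $\mathcal{F}$ is the set of points $(x,y)\in\mathbb{R}^2$ for which there are sequences $(t_n)$ and $(\tilde t_n)$ in $[s_1,s_2]$, with $t_n\neq\tilde t_n$ for all $n$, both converging to some common $t\in[s_1,s_2]$, such that $(x,y)$ is a limit of points $p_n\in\mathcal{C}_{t_n}\cap\mathcal{C}_{\tilde t_n}$. The discriminant envelope $E_3$ of $\mathcal{F}$ is the set of points $(x,y)\in\mathbb{R}^2$ for which there is $t\in[s_1,s_2]$ with both $F(x,y,t)=0$ and $F_t(x,y,t)=0$, where $F_t$ is the partial derivative in $t$. Derivatives at the endpoints $s_1,s_2$ are one-sided. If $r(t)=0$ at an endpoint $t$, then $\mathcal{C}_t$ is the single point $(x_c(t),y_c(t))$ and $\mathcal{D}_t=\{(x,y): F(x,y,t)<0\}$ is empty. $\partial\Omega$ is the topological boundary of $\Omega$ in $\mathbb{R}^2$. *)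

theory Defs
  imports "HOL-Analysis.Analysis"
begin

(* C^2 on the closed interval [a,b]: the derivatives are taken within [a,b], hence one-sided at a
   and b, and the values of f outside [a,b] are irrelevant.  The library's C1_differentiable_on
   demands two-sided derivatives at the endpoints. *)
definition C2_on :: "real \<Rightarrow> real \<Rightarrow> (real \<Rightarrow> real) \<Rightarrow> bool" where
  "C2_on a b f \<longleftrightarrow> (\<exists>f' f''.
     (\<forall>t\<in>{a..b}. (f has_real_derivative f' t) (at t within {a..b})) \<and>
     (\<forall>t\<in>{a..b}. (f' has_real_derivative f'' t) (at t within {a..b})) \<and>
     continuous_on {a..b} f'')"

definition circle_fun ::
  "(real \<Rightarrow> real) \<Rightarrow> (real \<Rightarrow> real) \<Rightarrow> (real \<Rightarrow> real) \<Rightarrow> real \<Rightarrow> real \<Rightarrow> real \<Rightarrow> real" where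
  "circle_fun xc yc r x y t = (x - xc t)\<^sup>2 + (y - yc t)\<^sup>2 - (r t)\<^sup>2"

definition zero_curve :: "(real \<Rightarrow> real \<Rightarrow> real \<Rightarrow> real) \<Rightarrow> real \<Rightarrow> (real \<times> real) set" where
  "zero_curve F t = {(x, y). F x y t = 0}"

(* For F = circle_fun xc yc r this is the open disk of radius r t about (xc t, yc t) when
   r t > 0, and it is empty when r t = 0. *)
definition neg_region :: "(real \<Rightarrow> real \<Rightarrow> real \<Rightarrow> real) \<Rightarrow> real \<Rightarrow> (real \<times> real) set" where
  "neg_region F t = {(x, y). F x y t < 0}"

definition limiting_envelope ::
  "real \<Rightarrow> real \<Rightarrow> (real \<Rightarrow> (real \<times> real) set) \<Rightarrow> (real \<times> real) set" where
  "limiting_envelope a b C = {q. \<exists>(u :: nat \<Rightarrow> real) (v :: nat \<Rightarrow> real) t (p :: nat \<Rightarrow> real \<times> real).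
     t \<in> {a..b} \<and>
     (\<forall>n. u n \<in> {a..b} \<and> v n \<in> {a..b} \<and> u n \<noteq> v n) \<and>
     u \<longlonglongrightarrow> t \<and> v \<longlonglongrightarrow> t \<and>
     (\<forall>n. p n \<in> C (u n) \<inter> C (v n)) \<and> p \<longlonglongrightarrow> q}"

(* "F_t(x,y,t) = 0" reads: the derivative in t within [a,b] (one-sided at a and b) exists and
   is 0.  It is unique if it exists, since a < b in the intended use. *)
definition discriminant_envelope ::
  "real \<Rightarrow> real \<Rightarrow> (real \<Rightarrow> real \<Rightarrow> real \<Rightarrow> real) \<Rightarrow> (real \<times> real) set" where
  "discriminant_envelope a b F = {(x, y). \<exists>t\<in>{a..b}. F x y t = 0 \<and>
     ((\<lambda>s. F x y s) has_real_derivative 0) (at t within {a..b})}"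

end

theory Submission
  imports Defs
begin

text \<open>A boundary point \<open>q\<close> of \<open>\<Omega>\<close> satisfies \<open>F q s \<ge> 0\<close> for all \<open>s\<close>, with equality at some \<open>t\<close>.
  Suppose \<open>t\<close> is not an endpoint. Either \<open>F q\<close> has two distinct zeros arbitrarily close to \<open>t\<close>, so that
  \<open>q\<close> itself lies on two nearby circles, or \<open>t\<close> is an isolated zero. In the latter case \<open>F q > 0\<close> on both
  sides of \<open>t\<close>, and a point \<open>p\<close> of \<open>\<D>\<^sub>t\<close> close to \<open>q\<close> has \<open>F p t < 0\<close>; by the intermediate value theorem
  \<open>F p\<close> vanishes on both sides of \<open>t\<close>.
  For the second inclusion, Rolle's theorem gives a zero of \<open>F\<^sub>t\<close> between the parameters of two
  intersecting circles, and this equation passes to the limit.\<close>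

text \<open>Turns the search for three sequences into one estimate: take \<open>e = 1/(n+1)\<close>
  and choose \<open>u n\<close>, \<open>v n\<close>, \<open>p n\<close> for each \<open>n\<close>.
  The common limit \<open>t\<close> is fixed before \<open>e\<close>.\<close>

lemma limiting_envelopeI:
  fixes t :: real and q :: "real \<times> real"
  assumes t: "t \<in> {a..b}"
    and ex: "\<And>e. e > 0 \<Longrightarrow> \<exists>u v p. u \<in> {a..b} \<and> v \<in> {a..b} \<and> u \<noteq> v \<and>
      dist u t < e \<and> dist v t < e \<and> p \<in> C u \<inter> C v \<and> dist p q < e"
  shows "q \<in> limiting_envelope a b C"
proof -
  have "\<forall>n. \<exists>u v p. u \<in> {a..b} \<and> v \<in> {a..b} \<and> u \<noteq> v \<and> dist u t < inverse (real (Suc n)) \<and>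
      dist v t < inverse (real (Suc n)) \<and> p \<in> C u \<inter> C v \<and> dist p q < inverse (real (Suc n))"
    using ex by (metis inverse_positive_iff_positive of_nat_0_less_iff zero_less_Suc)
  then obtain u v p where uvp: "\<And>n. u n \<in> {a..b} \<and> v n \<in> {a..b} \<and> u n \<noteq> v n \<and>
      dist (u n) t < inverse (real (Suc n)) \<and> dist (v n) t < inverse (real (Suc n)) \<and>
      p n \<in> C (u n) \<inter> C (v n) \<and> dist (p n) q < inverse (real (Suc n))"
    by metis
  have lim: "w \<longlonglongrightarrow> l" if "\<And>n. dist (w n) l < inverse (real (Suc n))"
    for w :: "nat \<Rightarrow> 'z::metric_space" and l
    by (rule iffD2[OF tendsto_dist_iff], rule tendsto_sandwich[OF _ _ tendsto_const
          LIMSEQ_inverse_real_of_nat]) (use that in \<open>auto intro!: always_eventually less_imp_le\<close>)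
  have "u \<longlonglongrightarrow> t" "v \<longlonglongrightarrow> t" "p \<longlonglongrightarrow> q"
    using uvp by (auto intro!: lim)
  with t uvp show ?thesis
    unfolding limiting_envelope_def by blast
qed

text \<open>Here \<open>clos\<close> stands for the geometric fact that a circle of positive radius
  lies in the closure of its open disk. It supplies points near \<open>q\<close> at which
  \<open>F\<close> is negative at parameter \<open>t\<close>.\<close>

lemma frontier_subset_limiting_envelope:
  fixes F :: "real \<Rightarrow> real \<Rightarrow> real \<Rightarrow> real"
  assumes cont: "continuous_on (UNIV \<times> {a..b}) (\<lambda>(z, t). F (fst z) (snd z) t)"
    and clos: "\<And>t. t \<in> {a<..<b} \<Longrightarrow> zero_curve F t \<subseteq> closure (neg_region F t)"
  shows "frontier (\<Union>t\<in>{a..b}. neg_region F t)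
    \<subseteq> limiting_envelope a b (zero_curve F) \<union> zero_curve F a \<union> zero_curve F b"
proof
  let ?f = "\<lambda>z t. F (fst z) (snd z) t"
  let ?\<Omega> = "\<Union>t\<in>{a..b}. neg_region F t"
  have neg: "z \<in> neg_region F t \<longleftrightarrow> ?f z t < 0" and zero: "z \<in> zero_curve F t \<longleftrightarrow> ?f z t = 0" for z t
    by (auto simp: neg_region_def zero_curve_def)
  have "continuous_on UNIV (\<lambda>z. case (z, t) of (z, t) \<Rightarrow> ?f z t)" if "t \<in> {a..b}" for t
    by (rule continuous_on_compose2[OF cont]) (use that in \<open>auto intro!: continuous_intros\<close>)
  then have cont_z: "continuous_on UNIV (\<lambda>z. ?f z t)" if "t \<in> {a..b}" for t
    using that by simp
  have "continuous_on {a..b} (\<lambda>t. case (z, t) of (z, t) \<Rightarrow> ?f z t)" for z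
    by (rule continuous_on_compose2[OF cont]) (auto intro!: continuous_intros)
  then have cont_t: "continuous_on {a..b} (?f z)" for z
    by simp
  fix q
  assume q: "q \<in> frontier ?\<Omega>"
  have "open ?\<Omega>"
  proof (intro open_UN ballI)
    fix t assume "t \<in> {a..b}"
    then have "open {z. ?f z t < 0}"
      by (intro open_Collect_less cont_z continuous_on_const)
    then show "open (neg_region F t)"
      by (simp add: neg_region_def case_prod_unfold)
  qed
  with q have "q \<in> closure ?\<Omega>" "q \<notin> ?\<Omega>"
    by (auto simp: frontier_def interior_open)
  then have nonneg: "?f q s \<ge> 0" if "s \<in> {a..b}" for s
    using that \<open>q \<notin> ?\<Omega>\<close> by (simp add: neg not_less)
  \<comment> \<open>Points of \<Omega> tending to \<open>q\<close> carry parameters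
    \<open>s n\<close>. Compactness of \<open>{a..b}\<close> makes a subsequence of these converge
    to some \<open>t\<close>, and joint continuity gives \<open>F\<close> \<le> 0 at
    \<open>(q, t)\<close>.\<close>
  obtain z where z: "\<And>n. z n \<in> ?\<Omega>" "z \<longlonglongrightarrow> q"
    using \<open>q \<in> closure ?\<Omega>\<close> by (auto simp: closure_sequential)
  then have "\<forall>n. \<exists>s\<in>{a..b}. ?f (z n) s < 0"
    by (simp add: neg)
  then obtain s where s: "\<And>n. s n \<in> {a..b}" "\<And>n. ?f (z n) (s n) < 0"
    by metis
  obtain t k where t: "t \<in> {a..b}" and k: "strict_mono k" "(s \<circ> k) \<longlonglongrightarrow> t"
    using s(1) compact_Icc[of a b] unfolding compact_def by metis
  have "(\<lambda>n. (z (k n), s (k n))) \<longlonglongrightarrow> (q, t)"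
    using k LIMSEQ_subseq_LIMSEQ[OF z(2) k(1)] by (auto simp: o_def intro!: tendsto_Pair)
  from continuous_on_tendsto_compose[OF cont this] s t
  have "(\<lambda>n. ?f (z (k n)) (s (k n))) \<longlonglongrightarrow> ?f q t"
    by auto
  then have "?f q t \<le> 0"
    using s(2) by (intro LIMSEQ_le_const2) (auto intro: less_imp_le)
  with nonneg[OF t] have ft: "?f q t = 0" by simp
  show "q \<in> limiting_envelope a b (zero_curve F) \<union> zero_curve F a \<union> zero_curve F b"
  proof (cases "t = a \<or> t = b")
    case True
    with ft show ?thesis by (auto simp: zero)
  next
    case False
    with t have ab: "a < t" "t < b" by auto
    have "q \<in> limiting_envelope a b (zero_curve F)"
    proof (rule limiting_envelopeI[OF t])
      fix e :: real
      assume "e > 0"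
      have "0 < min e (min (t - a) (b - t))"
        using \<open>e > 0\<close> ab by simp
      then obtain d where "0 < d" "d < min e (min (t - a) (b - t))"
        using dense by blast
      then have d: "d > 0" "d < e" "a \<le> t - d" "t + d \<le> b"
        by auto
      show "\<exists>u v p. u \<in> {a..b} \<and> v \<in> {a..b} \<and> u \<noteq> v \<and> dist u t < e \<and> dist v t < e \<and>
          p \<in> zero_curve F u \<inter> zero_curve F v \<and> dist p q < e"
      \<comment> \<open>Testing the two parameters at distance \<open>d\<close> is enough for this
        \<open>e\<close>: a zero there pairs with \<open>t\<close> and \<open>p = q\<close> works;
        otherwise \<open>F\<close> at \<open>q\<close> is positive at both, by
        \<open>nonneg\<close>.\<close>
      proof (cases "?f q (t - d) = 0 \<or> ?f q (t + d) = 0")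
        case True
        then obtain u where "u \<in> {t - d, t + d}" "?f q u = 0"
          by auto
        moreover from this have "u \<in> {a..b}" "u \<noteq> t" "dist u t < e"
          using d t by (auto simp: dist_real_def)
        moreover have "q \<in> zero_curve F u \<inter> zero_curve F t"
          using ft \<open>?f q u = 0\<close> by (simp add: zero)
        ultimately show ?thesis
          using t \<open>e > 0\<close> by (metis dist_self)
      next
        case False
        then have pos: "?f q (t - d) > 0" "?f q (t + d) > 0"
          using nonneg[of "t - d"] nonneg[of "t + d"] d t by auto
        \<comment> \<open>Points of this neighbourhood of \<open>q\<close> keep both positive signs,
          so one that also lies in \<open>neg_region F t\<close> has a sign change on each side of
          \<open>t\<close>.\<close>
        let ?U = "ball q e \<inter> ({z. ?f z (t - d) > 0} \<inter> {z. ?f z (t + d) > 0})"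
        have "open ?U"
          using d t by (intro open_Int open_ball open_Collect_less cont_z continuous_on_const) auto
        moreover have "q \<in> ?U"
          using pos \<open>e > 0\<close> by simp
        moreover have "q \<in> closure (neg_region F t)"
          using clos[of t] ab ft zero by (meson greaterThanLessThan_iff subsetD)
        ultimately have "?U \<inter> neg_region F t \<noteq> {}"
          using open_Int_closure_eq_empty[of ?U "neg_region F t"] by blast
        then obtain p where p: "p \<in> ?U" "p \<in> neg_region F t"
          by blast
        then have p: "dist p q < e" "?f p (t - d) > 0" "?f p (t + d) > 0" "?f p t < 0"
          by (simp_all add: dist_commute neg)
        have sub: "{t - d..t} \<subseteq> {a..b}" "{t..t + d} \<subseteq> {a..b}"
          using d t by auto
        obtain u where u: "t - d \<le> u" "u \<le> t" "?f p u = 0"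
          using IVT2'[OF _ _ _ continuous_on_subset[OF cont_t sub(1)], of p 0] p d
          by (meson diff_le_eq le_add_same_cancel1 less_imp_le)
        obtain v where v: "t \<le> v" "v \<le> t + d" "?f p v = 0"
          using IVT'[OF _ _ _ continuous_on_subset[OF cont_t sub(2)], of p 0] p d
          by (meson le_add_same_cancel1 less_imp_le)
        \<comment> \<open>Since \<open>u \<le> t \<le> v\<close>, this already separates
          \<open>u\<close> from \<open>v\<close>.\<close>
        have "u \<noteq> t"
          using u(3) p(4) by (metis less_irrefl)
        with u v d sub have "u \<in> {a..b}" "v \<in> {a..b}" "u \<noteq> v" "dist u t < e" "dist v t < e"
          by (auto simp: dist_real_def)
        moreover have "p \<in> zero_curve F u \<inter> zero_curve F v"
          using u(3) v(3) by (simp add: zero)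
        ultimately show ?thesis
          using p(1) by blast
      qed
    qed
    then show ?thesis by simp
  qed
qed

text \<open>The points \<open>u\<close> and \<open>v\<close> come in no fixed order and may be
  endpoints of the interval, where only a one-sided derivative is given. Restricting the derivatives
  to the interval between them allows the mean value theorem to be applied.\<close>

lemma Rolle_within_Icc:
  fixes g g' :: "real \<Rightarrow> real"
  assumes "\<And>s. s \<in> {a..b} \<Longrightarrow> (g has_real_derivative g' s) (at s within {a..b})"
    and "u \<in> {a..b}" "v \<in> {a..b}" "u \<noteq> v" "g u = g v"
  obtains w where "w \<in> {min u v<..<max u v}" "g' w = 0"
proof -
  let ?l = "min u v" and ?h = "max u v"
  have sub: "{?l..?h} \<subseteq> {a..b}" and lh: "?l < ?h" and eq: "g ?h = g ?l"
    using assms by (auto simp: min_def max_def)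
  have "(g has_derivative (*) (g' s)) (at s within {?l..?h})" if "?l \<le> s" "s \<le> ?h" for s
    using DERIV_subset[OF assms(1) sub, of s] that sub unfolding has_field_derivative_def
    by (meson atLeastAtMost_iff subsetD)
  from mvt_simple[OF lh this] obtain w where "w \<in> {?l<..<?h}" "g ?h - g ?l = g' w * (?h - ?l)"
    by blast
  with eq lh that show thesis by auto
qed

text \<open>The point \<open>p n\<close> and the parameter move at the same time, so joint
  continuity of \<open>F\<close> and of \<open>F'\<close> is what carries both equations to the
  limit.\<close>

lemma limiting_envelope_subset_discriminant_envelope:
  fixes F F' :: "real \<Rightarrow> real \<Rightarrow> real \<Rightarrow> real"
  assumes cont: "continuous_on (UNIV \<times> {a..b}) (\<lambda>(z, t). F (fst z) (snd z) t)"
    and cont': "continuous_on (UNIV \<times> {a..b}) (\<lambda>(z, t). F' (fst z) (snd z) t)"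
    and deriv: "\<And>x y t. t \<in> {a..b} \<Longrightarrow> (F x y has_real_derivative F' x y t) (at t within {a..b})"
  shows "limiting_envelope a b (zero_curve F) \<subseteq> discriminant_envelope a b F"
proof
  fix q
  assume "q \<in> limiting_envelope a b (zero_curve F)"
  then obtain u v t p where t: "t \<in> {a..b}"
    and uv: "\<And>n. u n \<in> {a..b}" "\<And>n. v n \<in> {a..b}" "\<And>n. u n \<noteq> v n"
    and lim: "u \<longlonglongrightarrow> t" "v \<longlonglongrightarrow> t" "p \<longlonglongrightarrow> q"
    and p: "\<And>n. p n \<in> zero_curve F (u n) \<inter> zero_curve F (v n)"
    unfolding limiting_envelope_def by blast
  have p0: "F (fst (p n)) (snd (p n)) (u n) = 0" "F (fst (p n)) (snd (p n)) (v n) = 0" for n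
    using p[of n] by (auto simp: zero_curve_def)
  have "\<exists>w. w \<in> {min (u n) (v n)<..<max (u n) (v n)} \<and> F' (fst (p n)) (snd (p n)) w = 0" for n
    using Rolle_within_Icc[OF deriv uv] p0 by metis
  then obtain w where w: "\<And>n. w n \<in> {min (u n) (v n)<..<max (u n) (v n)}"
      "\<And>n. F' (fst (p n)) (snd (p n)) (w n) = 0"
    by metis
  have w_in: "w n \<in> {a..b}" for n
    using w(1)[of n] uv(1,2)[of n] by (auto simp: min_def max_def split: if_splits)
  \<comment> \<open>The Rolle points are squeezed between sequences with the same limit.\<close>
  have "w \<longlonglongrightarrow> t"
  proof (rule tendsto_sandwich)
    show "(\<lambda>n. min (u n) (v n)) \<longlonglongrightarrow> t" "(\<lambda>n. max (u n) (v n)) \<longlonglongrightarrow> t"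
      using tendsto_min[OF lim(1,2)] tendsto_max[OF lim(1,2)] by auto
  qed (use w(1) in \<open>auto intro!: always_eventually less_imp_le\<close>)
  have "(\<lambda>n. F (fst (p n)) (snd (p n)) (u n)) \<longlonglongrightarrow> F (fst q) (snd q) t"
    using continuous_on_tendsto_compose[OF cont tendsto_Pair[OF lim(3,1)]] t uv by auto
  then have "F (fst q) (snd q) t = 0"
    using p0 by (simp add: LIMSEQ_const_iff)
  moreover have "(\<lambda>n. F' (fst (p n)) (snd (p n)) (w n)) \<longlonglongrightarrow> F' (fst q) (snd q) t"
    using continuous_on_tendsto_compose[OF cont' tendsto_Pair[OF lim(3) \<open>w \<longlonglongrightarrow> t\<close>]] t w_in by auto
  then have "F' (fst q) (snd q) t = 0"
    using w(2) by (simp add: LIMSEQ_const_iff)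
  ultimately show "q \<in> discriminant_envelope a b F"
    using t deriv[OF t, of "fst q" "snd q"]
    unfolding discriminant_envelope_def case_prod_unfold by (metis (mono_tags, lifting) mem_Collect_eq)
qed

lemma dist_Pair_eq_sqrt: "dist (a, b) (x, y) = sqrt ((x - a)\<^sup>2 + (y - b)\<^sup>2)" for a b x y :: real
  unfolding dist_Pair_Pair dist_real_def power2_abs by (metis power2_commute)

text \<open>The sign of \<open>r t\<close> matters because the square root of its square is its
  absolute value; for a negative radius the sphere would be empty.\<close>

lemma zero_curve_circle_fun:
  assumes "r t \<ge> 0"
  shows "zero_curve (circle_fun xc yc r) t = sphere (xc t, yc t) (r t)"
proof -
  have "A - (r t)\<^sup>2 = 0 \<longleftrightarrow> sqrt A = r t" for A
    using real_sqrt_eq_iff[of A "(r t)\<^sup>2"] assms by simp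
  then show ?thesis
    by (simp only: zero_curve_def circle_fun_def sphere_def case_prod_unfold set_eq_iff
        mem_Collect_eq split_paired_All dist_Pair_eq_sqrt fst_conv snd_conv simp_thms)
qed

lemma neg_region_circle_fun:
  assumes "r t \<ge> 0"
  shows "neg_region (circle_fun xc yc r) t = ball (xc t, yc t) (r t)"
proof -
  have "A - (r t)\<^sup>2 < 0 \<longleftrightarrow> sqrt A < r t" for A
    using real_sqrt_less_iff[of A "(r t)\<^sup>2"] assms by simp
  then show ?thesis
    by (simp only: neg_region_def circle_fun_def ball_def case_prod_unfold set_eq_iff
        mem_Collect_eq split_paired_All dist_Pair_eq_sqrt fst_conv snd_conv simp_thms)
qed

theorem theorem4p1:
  fixes s1 s2 :: real
    and xc yc r :: "real \<Rightarrow> real"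
    and F :: "real \<Rightarrow> real \<Rightarrow> real \<Rightarrow> real"
    and C D :: "real \<Rightarrow> (real \<times> real) set"
    and E2 E3 \<Omega> :: "(real \<times> real) set"
  assumes "s1 < s2"
    and "C2_on s1 s2 xc" and "C2_on s1 s2 yc" and "C2_on s1 s2 r"
    and "\<And>t. t \<in> {s1<..<s2} \<Longrightarrow> r t > 0"
    and "\<And>t. t \<in> {s1<..<s2} \<Longrightarrow> (deriv r t)\<^sup>2 < (deriv xc t)\<^sup>2 + (deriv yc t)\<^sup>2"
  defines "F \<equiv> circle_fun xc yc r"
    and "C \<equiv> zero_curve F"
    and "D \<equiv> neg_region F"
    and "E2 \<equiv> limiting_envelope s1 s2 C"
    and "E3 \<equiv> discriminant_envelope s1 s2 F"
    and "\<Omega> \<equiv> (\<Union>t\<in>{s1..s2}. D t)"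
  shows "frontier \<Omega> \<subseteq> E2 \<union> C s1 \<union> C s2 \<and>
    E2 \<union> C s1 \<union> C s2 \<subseteq> E3 \<union> C s1 \<union> C s2"
proof -
  obtain xc' xc'' where xc: "\<And>t. t \<in> {s1..s2} \<Longrightarrow> (xc has_real_derivative xc' t) (at t within {s1..s2})"
      "\<And>t. t \<in> {s1..s2} \<Longrightarrow> (xc' has_real_derivative xc'' t) (at t within {s1..s2})"
    using assms(2) unfolding C2_on_def by blast
  obtain yc' yc'' where yc: "\<And>t. t \<in> {s1..s2} \<Longrightarrow> (yc has_real_derivative yc' t) (at t within {s1..s2})"
      "\<And>t. t \<in> {s1..s2} \<Longrightarrow> (yc' has_real_derivative yc'' t) (at t within {s1..s2})"
    using assms(3) unfolding C2_on_def by blast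
  obtain r' r'' where r: "\<And>t. t \<in> {s1..s2} \<Longrightarrow> (r has_real_derivative r' t) (at t within {s1..s2})"
      "\<And>t. t \<in> {s1..s2} \<Longrightarrow> (r' has_real_derivative r'' t) (at t within {s1..s2})"
    using assms(4) unfolding C2_on_def by blast
  \<comment> \<open>Differentiability gives continuity. This is applied to \<open>xc\<close>,
    \<open>yc\<close>, \<open>r\<close> and also to their first derivatives, whose continuity comes
    from the second derivatives.\<close>
  have cont_snd: "continuous_on (UNIV \<times> {s1..s2}) (\<lambda>p :: (real \<times> real) \<times> real. g (snd p))"
    if "\<And>t. t \<in> {s1..s2} \<Longrightarrow> (g has_real_derivative g' t) (at t within {s1..s2})" for g g'
    using DERIV_continuous_on[OF that] by (rule continuous_on_compose2) (auto intro: continuous_on_snd)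
  note cont_funs = xc[THEN cont_snd] yc[THEN cont_snd] r[THEN cont_snd]
  \<comment> \<open>The partial derivative of \<open>F\<close> in \<open>t\<close>, one-sided at
    \<open>s1\<close> and \<open>s2\<close>.\<close>
  define F' where "F' x y t = - (2 * (x - xc t) * xc' t) - 2 * (y - yc t) * yc' t - 2 * r t * r' t"
    for x y t
  have cont: "continuous_on (UNIV \<times> {s1..s2}) (\<lambda>(z, t). F (fst z) (snd z) t)"
    unfolding F_def circle_fun_def case_prod_unfold by (intro continuous_intros cont_funs)
  have cont': "continuous_on (UNIV \<times> {s1..s2}) (\<lambda>(z, t). F' (fst z) (snd z) t)"
    unfolding F'_def case_prod_unfold by (intro continuous_intros cont_funs)
  have deriv: "(F x y has_real_derivative F' x y t) (at t within {s1..s2})" if "t \<in> {s1..s2}" for x y t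
    unfolding F_def F'_def circle_fun_def[abs_def]
    by (rule derivative_eq_intros xc(1) yc(1) r(1) that refl)+ (simp add: algebra_simps)
  \<comment> \<open>As \<open>r t > 0\<close>, the closure of the open ball is the closed ball,
    which contains the sphere.\<close>
  have "zero_curve F t \<subseteq> closure (neg_region F t)" if "t \<in> {s1<..<s2}" for t
    using assms(5)[OF that] by (auto simp: F_def zero_curve_circle_fun neg_region_circle_fun)
  then have "frontier \<Omega> \<subseteq> E2 \<union> C s1 \<union> C s2"
    unfolding \<Omega>_def D_def E2_def C_def by (rule frontier_subset_limiting_envelope[OF cont])
  moreover have "E2 \<subseteq> E3"
    unfolding E2_def E3_def C_def
    by (rule limiting_envelope_subset_discriminant_envelope[OF cont cont' deriv])
  ultimately show ?thesis by blast
qed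

end
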